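(* Let $\Omega$ be a connected weighted simplicial complex on $[n]$ with a blending action of the finite group $G$ on $\Omega$. For any $G$-invariant $p\in\mathcal P=\mathbb R[\mathbf x^{[0]},\dots,\mathbf x^{[n]}]$ there exist two polynomials $q_1,q_2\in\mathcal P$ with $p=q_1-q_2$ such that both $q_1$ and $q_2$ have an $(\Omega,G)$-decomposition. If $n$ is even, one can choose $q_2=0$.
   Context: $[n]=\{0,\dots,n\}$ and $\mathbb N=\{0,1,2,\dots\}$. A weighted simplicial complex on $[n]$ is a map $\Omega$ from the power set of $[n]$ to $\mathbb N$ such that $\Omega(S_1)$ divides $\Omega(S_2)$ whenever $S_1\subseteq S_2$; it is always assumed that $\Omega(\{i\})\neq 0$ for all $i\in[n]$. Sets $S$ with $\Omega(S)\ne0$ are called simplices, inclusion-maximal simplices are called facets, and $\mathcal F$ is the set of facets. $\widetilde{\mathcal F}$ is the multiset containing each facet $F$ exactly $\Omega(F)$ times (copies are regarded as distinct elements), $c:\widetilde{\mathcal F}\to\mathcal F$ maps each copy to its underlying facet, and $\widetilde{\mathcal F}_i=\{\mathfrak f\in\widetilde{\mathcal F}: i\in c(\mathfrak f)\}$. Two vertices are neighbours if some facet contains both; $\Omega$ is connected if any two vertices are joined by a chain of consecutive neighbours. An action of a finite group $G$ on $\Omega$ consists of an action of $G$ on $[n]$ with $\Omega(gS)=\Omega(S)$ for all $g\in G$, $S\subseteq[n]$, together with an action of $G$ on the set $\widetilde{\mathcal F}$ such that $c(g\mathfrak f)=g\,c(\mathfrak f)$. The action is called blending if, whenever $g_0,\dots,g_n\in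 G$ satisfy $\{g_00,g_11,\dots,g_nn\}=[n]$, there exists $g\in G$ with $gi=g_ii$ for all $i\in[n]$ (this only concerns the action on $[n]$). For each $i\in[n]$, $\mathbf x^{[i]}=(x^{[i]}_1,\dots,x^{[i]}_{m_i})$ is a collection of variables, with $m_i=m_{gi}$ for all $g\in G$. If $m_i=m_j$ and $f\in\mathbb R[\mathbf x^{[i]}]$, then $f(\mathbf x^{[j]})$ denotes the polynomial obtained by substituting $\mathbf x^{[j]}$ for $\mathbf x^{[i]}$. $G$ acts on $\mathcal P$ by $(gp)(\mathbf x^{[0]},\dots,\mathbf x^{[n]})=p(\mathbf x^{[g0]},\dots,\mathbf x^{[gn]})$, and $p$ is $G$-invariant if $gp=p$ for all $g\in G$. For sets $A,\mathcal I$, $\mathcal I^A$ denotes the set of functions $A\to\mathcal I$. For $\alpha\in\mathcal I^{\widetilde{\mathcal F}}$, $\alpha_{|_i}$ is its restriction to $\widetilde{\mathcal F}_i$. For $\beta\in\mathcal I^{\widetilde{\mathcal F}_i}$ and $g\in G$, ${}^g\beta\in\mathcal I^{\widetilde{\mathcal F}_{gi}}$ is defined by $({}^g\beta)(\mathfrak f)=\beta(g^{-1}\mathfrak f)$. An $(\Omega,G)$-decomposition of a polynomial $p$ consists of a finite index set $\mathcal I$ and local polynomials $p^{[i]}_\beta\in\mathbb R[\mathbf x^{[i]}]$ for $i\in[n]$, $\beta\in\mathcal I^{\widetilde{\mathcal F}_i}$, such that $$p=\sum_{\alpha\in\mathcal I^{\widetilde{\mathcal F}}}p^{[0]}_{\alpha_{|_0}}(\mathbf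 x^{[0]})\cdots p^{[n]}_{\alpha_{|_n}}(\mathbf x^{[n]})$$ and $p^{[i]}_\beta(\mathbf x^{[i]})=p^{[gi]}_{{}^g\beta}(\mathbf x^{[i]})$ for all $i\in[n]$, $g\in G$, $\beta\in\mathcal I^{\widetilde{\mathcal F}_i}$. *)

theory Defs
  imports Complex_Main "HOL-Algebra.Group_Action" "HOL-Library.Poly_Mapping"
begin

section \<open>Weighted simplicial complexes on [n] = {0..n}\<close>

text \<open>A map \<open>\<Omega>\<close> on \<open>nat set\<close> represents a map on the power set of \<open>{0..n}\<close>; only its values on
  subsets of \<open>{0..n}\<close> are ever used.\<close>

definition weighted_simplicial_complex :: "nat \<Rightarrow> (nat set \<Rightarrow> nat) \<Rightarrow> bool" where
  "weighted_simplicial_complex n \<Omega> \<longleftrightarrow>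
     (\<forall>S1 S2. S1 \<subseteq> S2 \<and> S2 \<subseteq> {0..n} \<longrightarrow> \<Omega> S1 dvd \<Omega> S2) \<and>
     (\<forall>i\<in>{0..n}. \<Omega> {i} \<noteq> 0)"

definition simplices :: "nat \<Rightarrow> (nat set \<Rightarrow> nat) \<Rightarrow> nat set set" where
  "simplices n \<Omega> = {S. S \<subseteq> {0..n} \<and> \<Omega> S \<noteq> 0}"

definition facets :: "nat \<Rightarrow> (nat set \<Rightarrow> nat) \<Rightarrow> nat set set" where
  "facets n \<Omega> = {F \<in> simplices n \<Omega>. \<forall>S \<in> simplices n \<Omega>. F \<subseteq> S \<longrightarrow> S = F}"

text \<open>The multiset of facets with distinguishable copies: the \<open>\<Omega> F\<close> copies of \<open>F\<close> are the pairs
  \<open>(F, k)\<close> with \<open>k < \<Omega> F\<close>, so the map from copies to underlying facets is \<open>fst\<close>.\<close>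

type_synonym facet_copy = "nat set \<times> nat"

definition facet_copies :: "nat \<Rightarrow> (nat set \<Rightarrow> nat) \<Rightarrow> facet_copy set" where
  "facet_copies n \<Omega> = (SIGMA F:facets n \<Omega>. {..<\<Omega> F})"

definition facet_copies_at :: "nat \<Rightarrow> (nat set \<Rightarrow> nat) \<Rightarrow> nat \<Rightarrow> facet_copy set" where
  "facet_copies_at n \<Omega> i = {f \<in> facet_copies n \<Omega>. i \<in> fst f}"

definition neighbours :: "nat \<Rightarrow> (nat set \<Rightarrow> nat) \<Rightarrow> nat \<Rightarrow> nat \<Rightarrow> bool" where
  "neighbours n \<Omega> i j \<longleftrightarrow> (\<exists>F \<in> facets n \<Omega>. i \<in> F \<and> j \<in> F)"

definition connected_complex :: "nat \<Rightarrow> (nat set \<Rightarrow> nat) \<Rightarrow> bool" where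
  "connected_complex n \<Omega> \<longleftrightarrow> (\<forall>i\<in>{0..n}. \<forall>j\<in>{0..n}. (neighbours n \<Omega>)\<^sup>*\<^sup>* i j)"


section \<open>Group actions\<close>

text \<open>\<open>\<phi>\<close> is the action on the vertices, \<open>\<psi>\<close> the action on the facet copies.\<close>

definition complex_action ::
  "nat \<Rightarrow> (nat set \<Rightarrow> nat) \<Rightarrow> ('g, 'b) monoid_scheme \<Rightarrow> ('g \<Rightarrow> nat \<Rightarrow> nat) \<Rightarrow>
   ('g \<Rightarrow> facet_copy \<Rightarrow> facet_copy) \<Rightarrow> bool" where
  "complex_action n \<Omega> G \<phi> \<psi> \<longleftrightarrow>
     group_action G {0..n} \<phi> \<and>
     (\<forall>g \<in> carrier G. \<forall>S. S \<subseteq> {0..n} \<longrightarrow> \<Omega> (\<phi> g ` S) = \<Omega> S) \<and>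
     group_action G (facet_copies n \<Omega>) \<psi> \<and>
     (\<forall>g \<in> carrier G. \<forall>f \<in> facet_copies n \<Omega>. fst (\<psi> g f) = \<phi> g ` fst f)"

definition blending :: "nat \<Rightarrow> ('g, 'b) monoid_scheme \<Rightarrow> ('g \<Rightarrow> nat \<Rightarrow> nat) \<Rightarrow> bool" where
  "blending n G \<phi> \<longleftrightarrow>
     (\<forall>h. (\<forall>i\<in>{0..n}. h i \<in> carrier G) \<and> (\<lambda>i. \<phi> (h i) i) ` {0..n} = {0..n} \<longrightarrow>
        (\<exists>g \<in> carrier G. \<forall>i\<in>{0..n}. \<phi> g i = \<phi> (h i) i))"


section \<open>Polynomials\<close>

text \<open>Real polynomials in variables of type \<open>'v\<close> are finitely supported maps from monomials
  (exponent vectors) to coefficients; the product on \<open>poly_mapping\<close> is the convolution product.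
  The variable \<open>(i, j)\<close> is the \<open>j\<close>-th member of the \<open>i\<close>-th collection of variables.\<close>

type_synonym 'v mpolynomial = "('v \<Rightarrow>\<^sub>0 nat) \<Rightarrow>\<^sub>0 real"

definition mp_const :: "real \<Rightarrow> 'v mpolynomial" where
  "mp_const c = Poly_Mapping.single 0 c"

definition mp_var :: "'v \<Rightarrow> 'v mpolynomial" where
  "mp_var v = Poly_Mapping.single (Poly_Mapping.single v 1) 1"

definition mp_subst :: "('v \<Rightarrow> 'w mpolynomial) \<Rightarrow> 'v mpolynomial \<Rightarrow> 'w mpolynomial" where
  "mp_subst \<sigma> p =
     (\<Sum>t \<in> Poly_Mapping.keys p. mp_const (Poly_Mapping.lookup p t) *
        (\<Prod>v \<in> Poly_Mapping.keys t. \<sigma> v ^ Poly_Mapping.lookup t v))"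

definition mp_over :: "'v set \<Rightarrow> 'v mpolynomial set" where
  "mp_over V = {p. \<forall>t \<in> Poly_Mapping.keys p. Poly_Mapping.keys t \<subseteq> V}"

definition local_ring :: "(nat \<Rightarrow> nat) \<Rightarrow> nat \<Rightarrow> (nat \<times> nat) mpolynomial set" where
  "local_ring m i = mp_over ({i} \<times> {1..m i})"

definition global_ring :: "nat \<Rightarrow> (nat \<Rightarrow> nat) \<Rightarrow> (nat \<times> nat) mpolynomial set" where
  "global_ring n m = mp_over (SIGMA i:{0..n}. {1..m i})"

text \<open>\<open>at_block i f\<close> is \<open>f\<close> with the \<open>i\<close>-th collection of variables substituted for the
  collection \<open>f\<close> is written in.\<close>

definition at_block :: "nat \<Rightarrow> (nat \<times> nat) mpolynomial \<Rightarrow> (nat \<times> nat) mpolynomial" where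
  "at_block i f = mp_subst (\<lambda>(_, j). mp_var (i, j)) f"

definition poly_act ::
  "('g \<Rightarrow> nat \<Rightarrow> nat) \<Rightarrow> 'g \<Rightarrow> (nat \<times> nat) mpolynomial \<Rightarrow> (nat \<times> nat) mpolynomial" where
  "poly_act \<phi> g p = mp_subst (\<lambda>(i, j). mp_var (\<phi> g i, j)) p"

definition invariant_poly ::
  "('g, 'b) monoid_scheme \<Rightarrow> ('g \<Rightarrow> nat \<Rightarrow> nat) \<Rightarrow> (nat \<times> nat) mpolynomial \<Rightarrow> bool" where
  "invariant_poly G \<phi> p \<longleftrightarrow> (\<forall>g \<in> carrier G. poly_act \<phi> g p = p)"


section \<open>Invariant decompositions\<close>

definition translate ::
  "nat \<Rightarrow> (nat set \<Rightarrow> nat) \<Rightarrow> ('g, 'b) monoid_scheme \<Rightarrow> ('g \<Rightarrow> nat \<Rightarrow> nat) \<Rightarrow>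
   ('g \<Rightarrow> facet_copy \<Rightarrow> facet_copy) \<Rightarrow> 'g \<Rightarrow> nat \<Rightarrow> (facet_copy \<Rightarrow> 'i) \<Rightarrow> facet_copy \<Rightarrow> 'i" where
  "translate n \<Omega> G \<phi> \<psi> g i \<beta> =
     (\<lambda>f \<in> facet_copies_at n \<Omega> (\<phi> g i). \<beta> (\<psi> (inv\<^bsub>G\<^esub> g) f))"

definition is_decomposition ::
  "nat \<Rightarrow> (nat set \<Rightarrow> nat) \<Rightarrow> ('g, 'b) monoid_scheme \<Rightarrow> ('g \<Rightarrow> nat \<Rightarrow> nat) \<Rightarrow>
   ('g \<Rightarrow> facet_copy \<Rightarrow> facet_copy) \<Rightarrow> (nat \<Rightarrow> nat) \<Rightarrow> 'i set \<Rightarrow>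
   (nat \<Rightarrow> (facet_copy \<Rightarrow> 'i) \<Rightarrow> (nat \<times> nat) mpolynomial) \<Rightarrow> (nat \<times> nat) mpolynomial \<Rightarrow> bool" where
  "is_decomposition n \<Omega> G \<phi> \<psi> m I P p \<longleftrightarrow>
     finite I \<and>
     (\<forall>i\<in>{0..n}. \<forall>\<beta> \<in> facet_copies_at n \<Omega> i \<rightarrow>\<^sub>E I. P i \<beta> \<in> local_ring m i) \<and>
     p = (\<Sum>\<alpha> \<in> facet_copies n \<Omega> \<rightarrow>\<^sub>E I. \<Prod>i\<in>{0..n}. P i (restrict \<alpha> (facet_copies_at n \<Omega> i))) \<and>
     (\<forall>i\<in>{0..n}. \<forall>g \<in> carrier G. \<forall>\<beta> \<in> facet_copies_at n \<Omega> i \<rightarrow>\<^sub>E I.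
        P i \<beta> = at_block i (P (\<phi> g i) (translate n \<Omega> G \<phi> \<psi> g i \<beta>)))"

text \<open>Every finite index set is in bijection with a finite set of natural numbers, so quantifying
  over the latter loses no generality.\<close>

definition has_decomposition ::
  "nat \<Rightarrow> (nat set \<Rightarrow> nat) \<Rightarrow> ('g, 'b) monoid_scheme \<Rightarrow> ('g \<Rightarrow> nat \<Rightarrow> nat) \<Rightarrow>
   ('g \<Rightarrow> facet_copy \<Rightarrow> facet_copy) \<Rightarrow> (nat \<Rightarrow> nat) \<Rightarrow> (nat \<times> nat) mpolynomial \<Rightarrow> bool" where
  "has_decomposition n \<Omega> G \<phi> \<psi> m p \<longleftrightarrow>
     (\<exists>(I :: nat set) P. is_decomposition n \<Omega> G \<phi> \<psi> m I P p)"

end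

(* By blending, G acts through all permutations of [n] that preserve the orbits. Averaging the
   monomials of p over these permutations and applying the polarization identity
     sum over u of prod_i a_i(u i) = sum over S of (-1)^|[n] - S| prod_i (sum of a_i(j) for j in S, j in G i)
   writes p as a linear combination of products of local polynomials h_i, with h_i and h_(g i) equal
   up to renaming of variables. Such a sum is an (Omega, G)-decomposition whose local polynomials
   vanish at nonconstant index functions, because on a connected complex a function that is constant
   around each vertex is constant. A coefficient is absorbed by scaling every one of the n + 1 factors
   with its (n + 1)-st root, which is possible for nonnegative coefficients and, if n is even, for all. *)
theory Submission
  imports Defs
begin

section \<open>Substitution in polynomials\<close>

text \<open>The inner product of \<open>mp_subst\<close> on its own: the image of one monomial,
  which turns sums of exponents into products.\<close>

definition mon_subst :: "('v \<Rightarrow> 'w mpolynomial) \<Rightarrow> ('v \<Rightarrow>\<^sub>0 nat) \<Rightarrow> 'w mpolynomial" where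
  "mon_subst \<sigma> t = (\<Prod>v\<in>Poly_Mapping.keys t. \<sigma> v ^ Poly_Mapping.lookup t v)"

text \<open>Added indices have exponent 0 and contribute the factor 1. This lets monomials with
  different keys be compared over one common index set.\<close>

lemma mon_subst_superset:
  assumes "finite A" "Poly_Mapping.keys t \<subseteq> A"
  shows "mon_subst \<sigma> t = (\<Prod>v\<in>A. \<sigma> v ^ Poly_Mapping.lookup t v)"
  unfolding mon_subst_def using assms
  by (intro prod.mono_neutral_left) (auto simp: in_keys_iff)

lemma mon_subst_0 [simp]: "mon_subst \<sigma> 0 = 1"
  by (simp add: mon_subst_def)

lemma mon_subst_add: "mon_subst \<sigma> (s + t) = mon_subst \<sigma> s * mon_subst \<sigma> t"
proof -
  let ?A = "Poly_Mapping.keys s \<union> Poly_Mapping.keys t"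
  have "mon_subst \<sigma> (s + t) = (\<Prod>v\<in>?A. \<sigma> v ^ Poly_Mapping.lookup (s + t) v)"
    by (rule mon_subst_superset) (auto simp: Poly_Mapping.keys_add)
  also have "\<dots> = (\<Prod>v\<in>?A. \<sigma> v ^ Poly_Mapping.lookup s v) * (\<Prod>v\<in>?A. \<sigma> v ^ Poly_Mapping.lookup t v)"
    by (simp add: lookup_add power_add prod.distrib)
  finally show ?thesis
    by (simp add: mon_subst_superset[of ?A])
qed

lemma mon_subst_sum: "mon_subst \<sigma> (\<Sum>x\<in>A. f x) = (\<Prod>x\<in>A. mon_subst \<sigma> (f x))"
  by (induction A rule: infinite_finite_induct) (auto simp: mon_subst_add)

lemma mon_subst_single [simp]: "mon_subst \<sigma> (Poly_Mapping.single v k) = \<sigma> v ^ k"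
  by (simp add: mon_subst_def)

lemma mp_subst_superset:
  assumes "finite A" "Poly_Mapping.keys p \<subseteq> A"
  shows "mp_subst \<sigma> p = (\<Sum>t\<in>A. mp_const (Poly_Mapping.lookup p t) * mon_subst \<sigma> t)"
  unfolding mp_subst_def mon_subst_def[symmetric] using assms
  by (intro sum.mono_neutral_left) (auto simp: in_keys_iff mp_const_def)

lemma mp_subst_0 [simp]: "mp_subst \<sigma> 0 = 0"
  by (simp add: mp_subst_def)

lemma mp_subst_add: "mp_subst \<sigma> (p + q) = mp_subst \<sigma> p + mp_subst \<sigma> q"
proof -
  let ?A = "Poly_Mapping.keys p \<union> Poly_Mapping.keys q"
  have "mp_subst \<sigma> (p + q) = (\<Sum>t\<in>?A. mp_const (Poly_Mapping.lookup (p + q) t) * mon_subst \<sigma> t)"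
    by (rule mp_subst_superset) (auto simp: Poly_Mapping.keys_add)
  also have "\<dots> = (\<Sum>t\<in>?A. mp_const (Poly_Mapping.lookup p t) * mon_subst \<sigma> t) +
      (\<Sum>t\<in>?A. mp_const (Poly_Mapping.lookup q t) * mon_subst \<sigma> t)"
    by (simp add: lookup_add mp_const_def single_add distrib_right sum.distrib)
  finally show ?thesis
    by (simp add: mp_subst_superset[of ?A])
qed

lemma mp_subst_sum: "mp_subst \<sigma> (\<Sum>x\<in>A. f x) = (\<Sum>x\<in>A. mp_subst \<sigma> (f x))"
  by (induction A rule: infinite_finite_induct) (auto simp: mp_subst_add)

lemma mp_subst_single: "mp_subst \<sigma> (Poly_Mapping.single t c) = mp_const c * mon_subst \<sigma> t"
  by (cases "c = 0") (auto simp: mp_subst_def mon_subst_def mp_const_def)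

lemma lookup_mp_const_mult: "Poly_Mapping.lookup (mp_const c * p) t = c * Poly_Mapping.lookup p t"
  unfolding mp_const_def mult_map_scale_conv_mult[symmetric] by (simp add: map.rep_eq when_def)

lemma mp_const_mult: "mp_const (c * d) = mp_const c * mp_const d"
  by (simp add: mp_const_def mult_single)

lemma mp_subst_const_mult: "mp_subst \<sigma> (mp_const c * p) = mp_const c * mp_subst \<sigma> p"
proof -
  \<comment> \<open>Only an inclusion, since all keys disappear for \<open>c = 0\<close>; hence both
    sides are expanded over the keys of \<open>p\<close>.\<close>
  have "Poly_Mapping.keys (mp_const c * p) \<subseteq> Poly_Mapping.keys p"
    by (auto simp: in_keys_iff lookup_mp_const_mult)
  then show ?thesis
    by (simp add: mp_subst_superset[of "Poly_Mapping.keys p"] lookup_mp_const_mult mp_const_mult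
        sum_distrib_left mult.assoc)
qed

lemma mp_var_power: "mp_var v ^ k = Poly_Mapping.single (Poly_Mapping.single v k) 1"
  by (induction k) (auto simp: mp_var_def mult_single single_add[symmetric])

lemma mp_const_1 [simp]: "mp_const 1 = 1"
  by (simp add: mp_const_def)

lemma mp_const_power: "mp_const c ^ k = mp_const (c ^ k)"
  by (induction k) (auto simp: mp_const_mult)

lemma mp_const_uminus: "mp_const (- c) = - mp_const c"
  by (simp add: mp_const_def single_uminus)

section \<open>Closure properties of the polynomials in a given set of variables\<close>

lemma mp_over_0 [simp]: "0 \<in> mp_over V"
  by (simp add: mp_over_def)

lemma mp_over_add: "p \<in> mp_over V \<Longrightarrow> q \<in> mp_over V \<Longrightarrow> p + q \<in> mp_over V"
  unfolding mp_over_def using Poly_Mapping.keys_add[of p q] by blast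

lemma mp_over_sum: "(\<And>x. x \<in> A \<Longrightarrow> f x \<in> mp_over V) \<Longrightarrow> (\<Sum>x\<in>A. f x) \<in> mp_over V"
  by (induction A rule: infinite_finite_induct) (auto simp: mp_over_add)

lemma mp_over_mult: "p * q \<in> mp_over V" if "p \<in> mp_over V" "q \<in> mp_over V"
  unfolding mp_over_def
proof safe
  fix t v assume t: "t \<in> Poly_Mapping.keys (p * q)" "v \<in> Poly_Mapping.keys t"
  obtain a b where "a \<in> Poly_Mapping.keys p" "b \<in> Poly_Mapping.keys q" "t = a + b"
    using t(1) keys_mult[of p q] by blast
  with t(2) that show "v \<in> V"
    using Poly_Mapping.keys_add[of a b] unfolding mp_over_def by blast
qed

lemma mp_over_const [simp]: "mp_const c \<in> mp_over V"
  by (auto simp: mp_over_def mp_const_def)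

lemma mp_over_prod: "(\<And>x. x \<in> A \<Longrightarrow> f x \<in> mp_over V) \<Longrightarrow> (\<Prod>x\<in>A. f x) \<in> mp_over V"
  using mp_over_const[of 1]
  by (induction A rule: infinite_finite_induct) (auto simp: mp_over_mult)

lemma mp_over_mono: "V \<subseteq> W \<Longrightarrow> mp_over V \<subseteq> mp_over W"
  unfolding mp_over_def by blast

section \<open>Blocks of a monomial\<close>

text \<open>The factor of the monomial \<open>t\<close> in the \<open>j\<close>-th collection of variables, rewritten in the
  \<open>i\<close>-th collection.\<close>

definition block :: "(nat \<times> nat \<Rightarrow>\<^sub>0 nat) \<Rightarrow> nat \<Rightarrow> nat \<Rightarrow> (nat \<times> nat) mpolynomial" where
  "block t j i = (\<Prod>v\<in>{v \<in> Poly_Mapping.keys t. fst v = j}. mp_var (i, snd v) ^ Poly_Mapping.lookup t v)"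

text \<open>A block is a monomial with coefficient 1, so substituting into it reduces to
  \<open>mon_subst\<close>.\<close>

lemma block_eq_single:
  "block t j i = Poly_Mapping.single
     (\<Sum>v\<in>{v \<in> Poly_Mapping.keys t. fst v = j}.
        Poly_Mapping.single (i, snd v) (Poly_Mapping.lookup t v)) 1"
proof -
  have "(\<Prod>v\<in>A. Poly_Mapping.single (f v) (1::real)) = Poly_Mapping.single (\<Sum>v\<in>A. f v) 1"
    for A :: "(nat \<times> nat) set" and f :: "nat \<times> nat \<Rightarrow> nat \<times> nat \<Rightarrow>\<^sub>0 nat"
    by (induction A rule: infinite_finite_induct) (auto simp: mult_single)
  then show ?thesis
    by (simp add: block_def mp_var_power)
qed

text \<open>Renaming forgets the collection \<open>k\<close> in which the block was written. This is
  the source of all equivariance below.\<close>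

lemma at_block_block: "at_block i (block t j k) = block t j i"
proof -
  have "at_block i (block t j k) = mon_subst (\<lambda>(_, j). mp_var (i, j))
      (\<Sum>v\<in>{v \<in> Poly_Mapping.keys t. fst v = j}.
         Poly_Mapping.single (k, snd v) (Poly_Mapping.lookup t v))"
    unfolding block_eq_single at_block_def mp_subst_single by simp
  also have "\<dots> = block t j i"
    by (simp add: mon_subst_sum block_def)
  finally show ?thesis .
qed

lemma block_local:
  assumes "Poly_Mapping.keys t \<subseteq> (SIGMA i:{0..n}. {1..m i})" "m j = m i"
  shows "block t j i \<in> local_ring m i"
  unfolding local_ring_def block_def
proof (rule mp_over_prod)
  fix v assume v: "v \<in> {v \<in> Poly_Mapping.keys t. fst v = j}"
  then have "snd v \<in> {1..m i}"
    using assms by auto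
  then show "mp_var (i, snd v) ^ Poly_Mapping.lookup t v \<in> mp_over ({i} \<times> {1..m i})"
    by (auto simp: mp_var_power mp_over_def split: if_splits)
qed

section \<open>Polarization\<close>

text \<open>Inserting a fixed element pairs the subsets without it with those containing it, and the
  signs in each pair cancel.\<close>

lemma sum_Pow_neg_one:
  assumes "finite A"
  shows "(\<Sum>T\<in>Pow A. (- 1) ^ card T) = (if A = {} then 1 else (0 :: 'a :: comm_ring_1))"
  using assms
proof (induction A rule: finite_induct)
  case (insert x A)
  have "(\<Sum>T\<in>Pow (insert x A). (- 1) ^ card T) =
      (\<Sum>T\<in>Pow A. (- 1) ^ card T) + (\<Sum>T\<in>insert x ` Pow A. (- 1 :: 'a) ^ card T)"
    unfolding Pow_insert using insert by (intro sum.union_disjoint) auto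
  also have "(\<Sum>T\<in>insert x ` Pow A. (- 1 :: 'a) ^ card T) = (\<Sum>T\<in>Pow A. (- 1) ^ card (insert x T))"
    using insert.hyps by (subst sum.reindex) (auto simp: inj_on_def insert_ident)
  also have "\<dots> = (\<Sum>T\<in>Pow A. - ((- 1) ^ card T))"
  proof (intro sum.cong refl)
    fix T assume "T \<in> Pow A"
    then have "finite T" "x \<notin> T"
      using insert.hyps finite_subset by auto
    then show "(- 1 :: 'a) ^ card (insert x T) = - ((- 1) ^ card T)"
      by simp
  qed
  finally show ?case
    by (simp add: sum_negf)
qed simp

text \<open>Complementation in \<open>N\<close> turns the sets above \<open>A\<close> into the
  subsets of \<open>N - A\<close>.\<close>

lemma sum_Pow_above_neg_one:
  assumes "finite N" "A \<subseteq> N"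
  shows "(\<Sum>S\<in>{S \<in> Pow N. A \<subseteq> S}. (- 1) ^ card (N - S)) = (if A = N then 1 else (0 :: 'a :: comm_ring_1))"
proof -
  have "(\<Sum>S\<in>{S \<in> Pow N. A \<subseteq> S}. (- 1 :: 'a) ^ card (N - S)) = (\<Sum>T\<in>Pow (N - A). (- 1) ^ card T)"
    using assms(2)
    by (intro sum.reindex_bij_witness[where i = "\<lambda>T. N - T" and j = "\<lambda>S. N - S"]) (auto simp: double_diff)
  also have "\<dots> = (if A = N then 1 else 0)"
    using assms by (subst sum_Pow_neg_one) auto
  finally show ?thesis .
qed

text \<open>For \<open>B i = N\<close> this is Ryser's formula for the permanent. Expanding the
  products on the right gives the maps \<open>u\<close> with values in \<open>S\<close>; after
  exchanging the sums, the signs cancel unless \<open>u\<close> is onto \<open>N\<close>.\<close>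

lemma polarization:
  fixes a :: "'i \<Rightarrow> 'i \<Rightarrow> 'a :: comm_ring_1"
  assumes N: "finite N" and B: "\<And>i. i \<in> N \<Longrightarrow> B i \<subseteq> N"
  shows "(\<Sum>u\<in>{u \<in> Pi\<^sub>E N B. u ` N = N}. \<Prod>i\<in>N. a i (u i)) =
    (\<Sum>S\<in>Pow N. (- 1) ^ card (N - S) * (\<Prod>i\<in>N. \<Sum>j\<in>S \<inter> B i. a i j))"
proof -
  have fin: "finite (B i)" if "i \<in> N" for i
    using that B N finite_subset by blast
  have finP: "finite (Pi\<^sub>E N B)"
    using N fin by (intro finite_PiE) auto
  have sub: "u ` N \<subseteq> N" if "u \<in> Pi\<^sub>E N B" for u
    using that B by (auto simp: PiE_def Pi_def)
  have "(\<Sum>S\<in>Pow N. (- 1) ^ card (N - S) * (\<Prod>i\<in>N. \<Sum>j\<in>S \<inter> B i. a i j)) =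
      (\<Sum>S\<in>Pow N. \<Sum>u\<in>{u \<in> Pi\<^sub>E N B. u ` N \<subseteq> S}. (- 1) ^ card (N - S) * (\<Prod>i\<in>N. a i (u i)))"
  proof (rule sum.cong [OF refl])
    fix S
    have "Pi\<^sub>E N (\<lambda>i. S \<inter> B i) = {u \<in> Pi\<^sub>E N B. u ` N \<subseteq> S}"
      by (auto simp: PiE_def Pi_def)
    then show "(- 1) ^ card (N - S) * (\<Prod>i\<in>N. \<Sum>j\<in>S \<inter> B i. a i j) =
        (\<Sum>u\<in>{u \<in> Pi\<^sub>E N B. u ` N \<subseteq> S}. (- 1) ^ card (N - S) * (\<Prod>i\<in>N. a i (u i)))"
      using N fin by (simp add: prod_sum_PiE sum_distrib_left)
  qed
  also have "\<dots> = (\<Sum>u\<in>Pi\<^sub>E N B. \<Sum>S\<in>{S \<in> Pow N. u ` N \<subseteq> S}. (- 1) ^ card (N - S) * (\<Prod>i\<in>N. a i (u i)))"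
    using N finP by (intro sum.swap_restrict) auto
  also have "\<dots> = (\<Sum>u\<in>Pi\<^sub>E N B. if u ` N = N then \<Prod>i\<in>N. a i (u i) else 0)"
    unfolding sum_distrib_right[symmetric]
    by (intro sum.cong refl) (subst sum_Pow_above_neg_one[OF N sub], auto)
  also have "\<dots> = (\<Sum>u\<in>{u \<in> Pi\<^sub>E N B. u ` N = N}. \<Prod>i\<in>N. a i (u i))"
    using finP by (subst sum.inter_filter) auto
  finally show ?thesis ..
qed

section \<open>Decompositions from equivariant products\<close>

lemma facet_copies_finite: "finite (facet_copies n \<Omega>)"
proof -
  have "facets n \<Omega> \<subseteq> Pow {0..n}"
    by (auto simp: facets_def simplices_def)
  then show ?thesis
    unfolding facet_copies_def by (intro finite_SigmaI) (auto dest: finite_subset)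
qed

text \<open>The simplex \<open>{i}\<close> lies in a maximal one, whose weight is nonzero, so that
  its copy number 0 exists.\<close>

lemma facet_copies_at_nonempty:
  assumes "weighted_simplicial_complex n \<Omega>" "i \<in> {0..n}"
  shows "facet_copies_at n \<Omega> i \<noteq> {}"
proof -
  have fin: "finite (simplices n \<Omega>)"
    unfolding simplices_def by simp
  have "{i} \<in> simplices n \<Omega>"
    using assms by (auto simp: simplices_def weighted_simplicial_complex_def)
  then obtain F where F: "F \<in> simplices n \<Omega>" "{i} \<subseteq> F" "\<forall>S\<in>simplices n \<Omega>. F \<subseteq> S \<longrightarrow> F = S"
    using finite_has_maximal2[OF fin] by blast
  then have "(F, 0) \<in> facet_copies_at n \<Omega> i"
    by (auto simp: facet_copies_at_def facet_copies_def facets_def simplices_def)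
  then show ?thesis by blast
qed

lemma facet_nonempty:
  assumes "weighted_simplicial_complex n \<Omega>" "F \<in> facets n \<Omega>"
  shows "F \<noteq> {}"
proof
  assume "F = {}"
  moreover have "{0} \<in> simplices n \<Omega>"
    using assms(1) by (auto simp: simplices_def weighted_simplicial_complex_def)
  ultimately show False
    using assms(2) by (auto simp: facets_def)
qed

text \<open>Neighbours \<open>i\<close> and \<open>j\<close> lie in a common facet, and the value of
  \<alpha> at its copy 0 equals both \<open>c i\<close> and \<open>c j\<close>. Connectedness
  spreads the equality to all vertices, and every facet contains a vertex.\<close>

lemma locally_constant_imp_constant:
  assumes "weighted_simplicial_complex n \<Omega>" "connected_complex n \<Omega>"
    and \<alpha>: "\<And>i f. i \<in> {0..n} \<Longrightarrow> f \<in> facet_copies_at n \<Omega> i \<Longrightarrow> \<alpha> f = c i"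
    and f: "f \<in> facet_copies n \<Omega>"
  shows "\<alpha> f = c 0"
proof -
  have step: "c i = c j" if nb: "neighbours n \<Omega> i j" for i j
  proof -
    obtain F where F: "F \<in> facets n \<Omega>" "i \<in> F" "j \<in> F"
      using nb by (auto simp: neighbours_def)
    then have "(F, 0) \<in> facet_copies_at n \<Omega> i" "(F, 0) \<in> facet_copies_at n \<Omega> j" "i \<in> {0..n}" "j \<in> {0..n}"
      by (auto simp: facet_copies_at_def facet_copies_def facets_def simplices_def)
    then show ?thesis
      using \<alpha>[of i "(F, 0)"] \<alpha>[of j "(F, 0)"] by simp
  qed
  have const: "c i = c j" if "(neighbours n \<Omega>)\<^sup>*\<^sup>* i j" for i j
    using that by (induction rule: rtranclp_induct) (auto dest: step)
  have facet: "fst f \<in> facets n \<Omega>"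
    using f by (auto simp: facet_copies_def)
  then obtain i where i: "i \<in> fst f"
    using facet_nonempty[OF assms(1)] by blast
  then have "i \<in> {0..n}"
    using facet by (auto simp: facets_def simplices_def)
  moreover have "f \<in> facet_copies_at n \<Omega> i"
    using i f by (simp add: facet_copies_at_def)
  ultimately show ?thesis
    using \<alpha>[of i f] const[of 0 i] assms(2) by (simp add: connected_complex_def)
qed

section \<open>Translation of index functions and the construction of decompositions\<close>

lemma facet_copies_at_act:
  assumes act: "complex_action n \<Omega> G \<phi> \<psi>" and g: "g \<in> carrier G"
    and f: "f \<in> facet_copies_at n \<Omega> i"
  shows "\<psi> g f \<in> facet_copies_at n \<Omega> (\<phi> g i)"
proof -
  interpret F: group_action G "facet_copies n \<Omega>" \<psi>
    using act by (simp add: complex_action_def)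
  have "f \<in> facet_copies n \<Omega>" "i \<in> fst f"
    using f by (auto simp: facet_copies_at_def)
  moreover from this have "\<psi> g f \<in> facet_copies n \<Omega>"
    using F.element_image[OF g _ refl] by blast
  ultimately show ?thesis
    using g act by (auto simp: facet_copies_at_def complex_action_def)
qed

text \<open>\<open>g\<close> and its inverse carry the copies at \<open>i\<close> to those at
  \<open>g i\<close> and back, so translation neither creates nor destroys constancy and keeps the
  value.\<close>

lemma translate_eq_constant_iff:
  assumes act: "complex_action n \<Omega> G \<phi> \<psi>" and g: "g \<in> carrier G" and i: "i \<in> {0..n}"
    and \<beta>: "\<beta> \<in> facet_copies_at n \<Omega> i \<rightarrow>\<^sub>E I"
  shows "translate n \<Omega> G \<phi> \<psi> g i \<beta> = (\<lambda>f\<in>facet_copies_at n \<Omega> (\<phi> g i). l) \<longleftrightarrow>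
    \<beta> = (\<lambda>f\<in>facet_copies_at n \<Omega> i. l)"
proof -
  interpret V: group_action G "{0..n}" \<phi>
    using act by (simp add: complex_action_def)
  interpret F: group_action G "facet_copies n \<Omega>" \<psi>
    using act by (simp add: complex_action_def)
  have G: "group G"
    using V.group_hom by (simp add: group_hom_def)
  have inv: "inv\<^bsub>G\<^esub> g \<in> carrier G"
    using G g by (simp add: group.inv_closed)
  have gi: "\<phi> (inv\<^bsub>G\<^esub> g) (\<phi> g i) = i"
    using V.orbit_sym_aux[OF g i refl] .
  show ?thesis
  proof
    assume eq: "translate n \<Omega> G \<phi> \<psi> g i \<beta> = (\<lambda>f\<in>facet_copies_at n \<Omega> (\<phi> g i). l)"
    show "\<beta> = (\<lambda>f\<in>facet_copies_at n \<Omega> i. l)"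
    proof
      fix f
      show "\<beta> f = (\<lambda>f\<in>facet_copies_at n \<Omega> i. l) f"
      proof (cases "f \<in> facet_copies_at n \<Omega> i")
        case True
        then have "\<psi> (inv\<^bsub>G\<^esub> g) (\<psi> g f) = f"
          using F.orbit_sym_aux[OF g _ refl] by (simp add: facet_copies_at_def)
        then show ?thesis
          using fun_cong[OF eq, of "\<psi> g f"] True facet_copies_at_act[OF act g True]
          by (simp add: translate_def)
      qed (use \<beta> in auto)
    qed
  next
    assume \<beta>: "\<beta> = (\<lambda>f\<in>facet_copies_at n \<Omega> i. l)"
    show "translate n \<Omega> G \<phi> \<psi> g i \<beta> = (\<lambda>f\<in>facet_copies_at n \<Omega> (\<phi> g i). l)"
      unfolding translate_def \<beta> using facet_copies_at_act[OF act inv, of _ "\<phi> g i"] gi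
      by (intro restrict_ext) auto
  qed
qed

text \<open>The labels \<open>l\<close> of the summands serve as indices. The local polynomial at
  \<beta> is \<open>h l i\<close> if \<beta> is constantly \<open>l\<close>, and 0 if \<beta> is not
  constant, so that only the constant \<alpha> contribute to the global sum.\<close>

lemma is_decomposition_of_equivariant:
  assumes \<Omega>: "weighted_simplicial_complex n \<Omega>" "connected_complex n \<Omega>"
    and act: "complex_action n \<Omega> G \<phi> \<psi>" and L: "finite L"
    and loc: "\<And>l i. l \<in> L \<Longrightarrow> i \<in> {0..n} \<Longrightarrow> h l i \<in> local_ring m i"
    and equi: "\<And>l i g. l \<in> L \<Longrightarrow> i \<in> {0..n} \<Longrightarrow> g \<in> carrier G \<Longrightarrow> at_block i (h l (\<phi> g i)) = h l i"
  shows "is_decomposition n \<Omega> G \<phi> \<psi> m L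
    (\<lambda>i \<beta>. \<Sum>l\<in>L. if \<beta> = (\<lambda>f\<in>facet_copies_at n \<Omega> i. l) then h l i else 0)
    (\<Sum>l\<in>L. \<Prod>i\<in>{0..n}. h l i)"
    (is "is_decomposition _ _ _ _ _ _ _ ?P _")
  unfolding is_decomposition_def
proof (intro conjI ballI)
  show "finite L" by (fact L)
next
  fix i \<beta> assume "i \<in> {0..n}"
  then show "?P i \<beta> \<in> local_ring m i"
    using loc unfolding local_ring_def by (intro mp_over_sum) auto
next
  fix i g \<beta>
  assume i: "i \<in> {0..n}" and g: "g \<in> carrier G" and \<beta>: "\<beta> \<in> facet_copies_at n \<Omega> i \<rightarrow>\<^sub>E L"
  have "at_block i (?P (\<phi> g i) (translate n \<Omega> G \<phi> \<psi> g i \<beta>)) =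
      (\<Sum>l\<in>L. if \<beta> = (\<lambda>f\<in>facet_copies_at n \<Omega> i. l) then at_block i (h l (\<phi> g i)) else 0)"
    unfolding at_block_def mp_subst_sum translate_eq_constant_iff[OF act g i \<beta>]
    by (intro sum.cong) auto
  also have "\<dots> = ?P i \<beta>"
    using equi i g by (intro sum.cong) auto
  finally show "?P i \<beta> = at_block i (?P (\<phi> g i) (translate n \<Omega> G \<phi> \<psi> g i \<beta>))" ..
next
  let ?K = "\<lambda>l. \<lambda>f\<in>facet_copies n \<Omega>. l"
  let ?T = "\<lambda>\<alpha>. \<Prod>i\<in>{0..n}. ?P i (restrict \<alpha> (facet_copies_at n \<Omega> i))"
  have at_sub: "facet_copies_at n \<Omega> i \<subseteq> facet_copies n \<Omega>" for i
    by (auto simp: facet_copies_at_def)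
  have ne: "facet_copies_at n \<Omega> i \<noteq> {}" if "i \<in> {0..n}" for i
    using facet_copies_at_nonempty[OF \<Omega>(1) that] .
  \<comment> \<open>Different labels give different constant functions because some facet copy
    exists, for instance one at the vertex 0.\<close>
  have inj: "inj_on ?K L"
  proof (rule inj_onI)
    fix l l' assume eq: "?K l = ?K l'"
    obtain f where "f \<in> facet_copies n \<Omega>"
      using ne[of 0] at_sub by auto
    then show "l = l'"
      using fun_cong[OF eq, of f] by simp
  qed
  have "(\<Sum>\<alpha>\<in>facet_copies n \<Omega> \<rightarrow>\<^sub>E L. ?T \<alpha>) = (\<Sum>\<alpha>\<in>?K ` L. ?T \<alpha>)"
  proof (rule sum.mono_neutral_right)
    show "finite (facet_copies n \<Omega> \<rightarrow>\<^sub>E L)"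
      using facet_copies_finite L by (intro finite_PiE) auto
    show "?K ` L \<subseteq> facet_copies n \<Omega> \<rightarrow>\<^sub>E L"
      by auto
    show "\<forall>\<alpha>\<in>(facet_copies n \<Omega> \<rightarrow>\<^sub>E L) - ?K ` L. ?T \<alpha> = 0"
    proof (intro ballI, rule ccontr)
      fix \<alpha> assume \<alpha>: "\<alpha> \<in> (facet_copies n \<Omega> \<rightarrow>\<^sub>E L) - ?K ` L" and nz: "?T \<alpha> \<noteq> 0"
      \<comment> \<open>A nonzero product has no zero factor, so \<alpha> is constant around each
        vertex.\<close>
      have "\<exists>l\<in>L. restrict \<alpha> (facet_copies_at n \<Omega> i) = (\<lambda>f\<in>facet_copies_at n \<Omega> i. l)"
        if "i \<in> {0..n}" for i
      proof (rule ccontr)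
        assume "\<not> ?thesis"
        then have "?P i (restrict \<alpha> (facet_copies_at n \<Omega> i)) = 0"
          by (intro sum.neutral) auto
        then have "?T \<alpha> = 0"
          using that by (intro prod_zero) auto
        with nz show False by contradiction
      qed
      then obtain c where c: "\<And>i. i \<in> {0..n} \<Longrightarrow> c i \<in> L \<and>
          restrict \<alpha> (facet_copies_at n \<Omega> i) = (\<lambda>f\<in>facet_copies_at n \<Omega> i. c i)"
        by metis
      have "\<alpha> f = c i" if "i \<in> {0..n}" "f \<in> facet_copies_at n \<Omega> i" for i f
        using fun_cong[OF conjunct2[OF c[OF that(1)]], of f] that by simp
      then have "\<alpha> f = c 0" if "f \<in> facet_copies n \<Omega>" for f
        using locally_constant_imp_constant[OF \<Omega>] that by blast
      then have "\<alpha> = ?K (c 0)"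
        using \<alpha> by (intro extensionalityI[of \<alpha> "facet_copies n \<Omega>"]) (auto simp: PiE_def)
      then show False
        using \<alpha> c[of 0] by auto
    qed
  qed
  also have "\<dots> = (\<Sum>l\<in>L. ?T (?K l))"
    by (simp add: sum.reindex[OF inj])
  also have "\<dots> = (\<Sum>l\<in>L. \<Prod>i\<in>{0..n}. h l i)"
  proof (intro sum.cong prod.cong refl)
    fix l i assume l: "l \<in> L" and i: "i \<in> {0..n}"
    obtain f where f: "f \<in> facet_copies_at n \<Omega> i"
      using ne[OF i] by blast
    \<comment> \<open>Since there is a copy at \<open>i\<close>, exactly one term of the sum
      defining the local polynomial survives.\<close>
    have "restrict (?K l) (facet_copies_at n \<Omega> i) = (\<lambda>f\<in>facet_copies_at n \<Omega> i. k) \<longleftrightarrow> l = k" for k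
    proof
      assume eq: "restrict (?K l) (facet_copies_at n \<Omega> i) = (\<lambda>f\<in>facet_copies_at n \<Omega> i. k)"
      show "l = k"
        using fun_cong[OF eq, of f] f at_sub[of i] by auto
    qed (use at_sub[of i] in \<open>auto simp: Int_absorb1\<close>)
    then show "?P i (restrict (?K l) (facet_copies_at n \<Omega> i)) = h l i"
      using l L by (simp add: sum.delta)
  qed
  finally show "(\<Sum>l\<in>L. \<Prod>i\<in>{0..n}. h l i) = (\<Sum>\<alpha>\<in>facet_copies n \<Omega> \<rightarrow>\<^sub>E L. ?T \<alpha>)" ..
qed

text \<open>Each of the \<open>n + 1\<close> factors takes the same root \<open>r\<close> of the
  coefficient; a scalar common to all vertices preserves equivariance.\<close>

lemma has_decomposition_of_equivariant:
  fixes L :: "'l set"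
  assumes \<Omega>: "weighted_simplicial_complex n \<Omega>" "connected_complex n \<Omega>"
    and act: "complex_action n \<Omega> G \<phi> \<psi>" and L: "finite L"
    and loc: "\<And>l i. l \<in> L \<Longrightarrow> i \<in> {0..n} \<Longrightarrow> h l i \<in> local_ring m i"
    and equi: "\<And>l i g. l \<in> L \<Longrightarrow> i \<in> {0..n} \<Longrightarrow> g \<in> carrier G \<Longrightarrow> at_block i (h l (\<phi> g i)) = h l i"
    and coeff: "\<And>l. l \<in> L \<Longrightarrow> \<exists>r. r ^ Suc n = c l"
  shows "has_decomposition n \<Omega> G \<phi> \<psi> m (\<Sum>l\<in>L. mp_const (c l) * (\<Prod>i\<in>{0..n}. h l i))"
proof -
  obtain r where r: "\<And>l. l \<in> L \<Longrightarrow> r l ^ Suc n = c l"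
    using coeff by metis
  \<comment> \<open>\<open>has_decomposition\<close> asks for indices in \<open>nat\<close>, so the
    labels are enumerated.\<close>
  obtain e where e: "bij_betw e {0..<card L} L"
    using ex_bij_betw_nat_finite[OF L] by blast
  then have eL: "e k \<in> L" if "k \<in> {0..<card L}" for k
    using that by (auto dest: bij_betwE)
  let ?h = "\<lambda>k i. mp_const (r (e k)) * h (e k) i"
  have "is_decomposition n \<Omega> G \<phi> \<psi> m {0..<card L}
      (\<lambda>i \<beta>. \<Sum>k\<in>{0..<card L}. if \<beta> = (\<lambda>f\<in>facet_copies_at n \<Omega> i. k) then ?h k i else 0)
      (\<Sum>k\<in>{0..<card L}. \<Prod>i\<in>{0..n}. ?h k i)"
  proof (rule is_decomposition_of_equivariant[OF \<Omega> act])
    fix k i assume "k \<in> {0..<card L}" "i \<in> {0..n}"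
    then show "?h k i \<in> local_ring m i"
      using loc eL unfolding local_ring_def by (intro mp_over_mult) auto
  next
    fix k i g assume "k \<in> {0..<card L}" "i \<in> {0..n}" "g \<in> carrier G"
    then show "at_block i (?h k (\<phi> g i)) = ?h k i"
      using equi eL by (simp add: at_block_def mp_subst_const_mult)
  qed simp
  moreover have "(\<Sum>k\<in>{0..<card L}. \<Prod>i\<in>{0..n}. ?h k i) =
      (\<Sum>l\<in>L. mp_const (c l) * (\<Prod>i\<in>{0..n}. h l i))"
  proof -
    have "(\<Sum>k\<in>{0..<card L}. \<Prod>i\<in>{0..n}. ?h k i) = (\<Sum>l\<in>L. \<Prod>i\<in>{0..n}. mp_const (r l) * h l i)"
      using sum.reindex_bij_betw[OF e] .
    also have "\<dots> = (\<Sum>l\<in>L. mp_const (c l) * (\<Prod>i\<in>{0..n}. h l i))"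
    proof (rule sum.cong [OF refl])
      fix l assume "l \<in> L"
      have "mp_const (r l) ^ Suc n = (mp_const (c l) :: (nat \<times> nat) mpolynomial)"
        using r[OF \<open>l \<in> L\<close>] by (simp only: mp_const_power)
      then show "(\<Prod>i\<in>{0..n}. mp_const (r l) * h l i) = mp_const (c l) * (\<Prod>i\<in>{0..n}. h l i)"
        by (simp add: prod.distrib del: power_Suc)
    qed
    finally show ?thesis .
  qed
  ultimately show ?thesis
    unfolding has_decomposition_def by metis
qed

section \<open>Invariant polynomials as sums of equivariant products\<close>

text \<open>The variables of each monomial are grouped by collection; the action moves the block of
  \<open>j\<close> to the collection \<open>g j\<close>.\<close>

lemma poly_act_eq:
  assumes "p \<in> global_ring n m"
  shows "poly_act \<phi> g p =
    (\<Sum>t\<in>Poly_Mapping.keys p. mp_const (Poly_Mapping.lookup p t) * (\<Prod>j\<in>{0..n}. block t j (\<phi> g j)))"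
  unfolding poly_act_def mp_subst_def
proof (intro sum.cong refl arg_cong2[where f = "(*)"])
  fix t assume "t \<in> Poly_Mapping.keys p"
  then have sub: "fst ` Poly_Mapping.keys t \<subseteq> {0..n}"
    using assms by (fastforce simp: global_ring_def mp_over_def)
  have "(\<Prod>j\<in>{0..n}. block t j (\<phi> g j)) =
      (\<Prod>j\<in>{0..n}. \<Prod>v\<in>{v \<in> Poly_Mapping.keys t. fst v = j}.
         (case v of (i, j) \<Rightarrow> mp_var (\<phi> g i, j)) ^ Poly_Mapping.lookup t v)"
    unfolding block_def by (intro prod.cong) auto
  also have "\<dots> = (\<Prod>v\<in>Poly_Mapping.keys t.
      (case v of (i, j) \<Rightarrow> mp_var (\<phi> g i, j)) ^ Poly_Mapping.lookup t v)"
    using sub by (intro prod.group) auto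
  finally show "(\<Prod>v\<in>Poly_Mapping.keys t.
      (case v of (i, j) \<Rightarrow> mp_var (\<phi> g i, j)) ^ Poly_Mapping.lookup t v) =
      (\<Prod>j\<in>{0..n}. block t j (\<phi> g j))" ..
qed

lemma invariant_as_permuted_blocks:
  assumes V: "group_action G {0..n} \<phi>" and p: "p \<in> global_ring n m" "invariant_poly G \<phi> p"
    and g: "g \<in> carrier G"
  shows "p = (\<Sum>t\<in>Poly_Mapping.keys p.
    mp_const (Poly_Mapping.lookup p t) * (\<Prod>i\<in>{0..n}. block t (\<phi> g i) i))"
proof -
  interpret V: group_action G "{0..n}" \<phi> by (fact V)
  have G: "group G"
    using V.group_hom by (simp add: group_hom_def)
  have inv: "inv\<^bsub>G\<^esub> g \<in> carrier G"
    using G g by (simp add: group.inv_closed)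
  have bij: "bij_betw (\<phi> g) {0..n} {0..n}"
    using V.bij_prop0[OF g] by (simp add: Bij_def)
  \<comment> \<open>Acting with the inverse and reindexing by \<open>j = g i\<close> puts the block
    of \<open>g i\<close> into the collection \<open>i\<close>.\<close>
  have "p = poly_act \<phi> (inv\<^bsub>G\<^esub> g) p"
    using p(2) inv by (simp add: invariant_poly_def)
  also have "\<dots> = (\<Sum>t\<in>Poly_Mapping.keys p.
      mp_const (Poly_Mapping.lookup p t) * (\<Prod>j\<in>{0..n}. block t j (\<phi> (inv\<^bsub>G\<^esub> g) j)))"
    by (rule poly_act_eq[OF p(1)])
  also have "\<dots> = (\<Sum>t\<in>Poly_Mapping.keys p.
      mp_const (Poly_Mapping.lookup p t) * (\<Prod>i\<in>{0..n}. block t (\<phi> g i) i))"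
  proof (intro sum.cong refl arg_cong2[where f = "(*)"])
    fix t
    have "(\<Prod>j\<in>{0..n}. block t j (\<phi> (inv\<^bsub>G\<^esub> g) j)) =
        (\<Prod>i\<in>{0..n}. block t (\<phi> g i) (\<phi> (inv\<^bsub>G\<^esub> g) (\<phi> g i)))"
      by (rule prod.reindex_bij_betw[OF bij, symmetric])
    also have "\<dots> = (\<Prod>i\<in>{0..n}. block t (\<phi> g i) i)"
      using V.orbit_sym_aux[OF g _ refl] by (intro prod.cong) auto
    finally show "(\<Prod>j\<in>{0..n}. block t j (\<phi> (inv\<^bsub>G\<^esub> g) j)) = (\<Prod>i\<in>{0..n}. block t (\<phi> g i) i)" .
  qed
  finally show ?thesis .
qed

section \<open>Orbits, blending and averaging\<close>

text \<open>Right multiplication by \<open>g\<close>, respectively by its inverse, converts elements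
  that reach a point from \<open>g x\<close> into elements that reach it from \<open>x\<close>, and
  conversely.\<close>

lemma orbit_act:
  assumes "group_action G E \<phi>" "g \<in> carrier G" "x \<in> E"
  shows "orbit G \<phi> (\<phi> g x) = orbit G \<phi> x"
proof -
  interpret group_action G E \<phi> by (fact assms(1))
  have G: "group G"
    using group_hom by (simp add: group_hom_def)
  have "\<phi> h (\<phi> g x) = \<phi> (h \<otimes>\<^bsub>G\<^esub> g) x" if "h \<in> carrier G" for h
    using composition_rule[OF assms(3) that assms(2)] by simp
  moreover have "\<phi> h x = \<phi> (h \<otimes>\<^bsub>G\<^esub> inv\<^bsub>G\<^esub> g) (\<phi> g x)" if "h \<in> carrier G" for h
    using composition_rule[of "\<phi> g x" h "inv\<^bsub>G\<^esub> g"] orbit_sym_aux[OF assms(2,3) refl]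
      element_image[OF assms(2,3) refl] group.inv_closed[OF G assms(2)] that by simp
  moreover have "h \<otimes>\<^bsub>G\<^esub> g \<in> carrier G" "h \<otimes>\<^bsub>G\<^esub> inv\<^bsub>G\<^esub> g \<in> carrier G" if "h \<in> carrier G" for h
    using G assms(2) that
    by (auto simp: group.is_monoid monoid.m_closed group.inv_closed)
  ultimately show ?thesis
    unfolding orbit_def by (auto; metis)
qed

text \<open>Membership in the orbits supplies a group element for each vertex separately; blending
  replaces them by a single one.\<close>

lemma blending_permutation:
  assumes "blending n G \<phi>" "u \<in> Pi\<^sub>E {0..n} (orbit G \<phi>)" "u ` {0..n} = {0..n}"
  shows "\<exists>g\<in>carrier G. \<forall>i\<in>{0..n}. u i = \<phi> g i"
proof -
  have "\<forall>i\<in>{0..n}. \<exists>h\<in>carrier G. u i = \<phi> h i"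
    using assms(2) by (auto simp: orbit_def PiE_def Pi_def)
  then obtain h where h: "\<forall>i\<in>{0..n}. h i \<in> carrier G \<and> u i = \<phi> (h i) i"
    by metis
  then have "(\<lambda>i. \<phi> (h i) i) ` {0..n} = {0..n}"
    using assms(3) by (metis (no_types, lifting) image_cong)
  then obtain g where "g \<in> carrier G" "\<forall>i\<in>{0..n}. \<phi> g i = \<phi> (h i) i"
    using assms(1) h unfolding blending_def by blast
  with h show ?thesis by metis
qed

lemma invariant_as_equivariant_sum:
  assumes V: "group_action G {0..n} \<phi>" and blend: "blending n G \<phi>"
    and m: "\<forall>g\<in>carrier G. \<forall>i\<in>{0..n}. m (\<phi> g i) = m i"
    and p: "p \<in> global_ring n m" "invariant_poly G \<phi> p"
  shows "\<exists>(L :: ((nat \<times> nat \<Rightarrow>\<^sub>0 nat) \<times> nat set) set) c h. finite L \<and>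
    (\<forall>l\<in>L. \<forall>i\<in>{0..n}. h l i \<in> local_ring m i) \<and>
    (\<forall>l\<in>L. \<forall>i\<in>{0..n}. \<forall>g\<in>carrier G. at_block i (h l (\<phi> g i)) = h l i) \<and>
    p = (\<Sum>l\<in>L. mp_const (c l) * (\<Prod>i\<in>{0..n}. h l i))"
proof -
  interpret V: group_action G "{0..n}" \<phi> by (fact V)
  let ?N = "{0..n}"
  let ?B = "orbit G \<phi>"
  have B: "?B i \<subseteq> ?N" if "i \<in> ?N" for i
    using V.element_image[OF _ that refl] by (auto simp: orbit_def)
  \<comment> \<open>As \<open>?N\<close> is finite, these surjections are the permutations of the
    vertices that preserve every orbit.\<close>
  define U where "U = {u \<in> Pi\<^sub>E ?N ?B. u ` ?N = ?N}"
  have finU: "finite U"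
    unfolding U_def using B finite_subset[OF B] by (intro finite_subset[OF _ finite_PiE[of ?N ?B]]) auto
  \<comment> \<open>The identity makes \<open>U\<close> nonempty, which the division by
    \<open>card U\<close> in the average requires.\<close>
  have "(\<lambda>i\<in>?N. i) \<in> U"
    unfolding U_def using V.id_eq_one[symmetric] V.orbit_refl by auto
  then have cardU: "card U \<noteq> 0"
    using finU by auto
  \<comment> \<open>Apart from the collection it is written in, \<open>h (t, S) i\<close> depends on
    \<open>i\<close> only through its orbit; this yields equivariance.\<close>
  define h where "h = (\<lambda>(t, S) i. \<Sum>j\<in>S \<inter> ?B i. block t j i)"
  \<comment> \<open>Coefficient of the monomial, times the sign from polarization, divided by the
    number of permutations averaged over.\<close>
  define c where "c = (\<lambda>(t, S). Poly_Mapping.lookup p t * (- 1) ^ card (?N - S) / card U)"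
  have pU: "p = (\<Sum>t\<in>Poly_Mapping.keys p. mp_const (Poly_Mapping.lookup p t) * (\<Prod>i\<in>?N. block t (u i) i))"
    if u: "u \<in> U" for u
  proof -
    have "u \<in> Pi\<^sub>E ?N ?B" "u ` ?N = ?N"
      using u by (auto simp only: U_def mem_Collect_eq)
    from blending_permutation[OF blend this]
    obtain g where g: "g \<in> carrier G" "\<forall>i\<in>?N. u i = \<phi> g i"
      by (elim bexE)
    have blocks: "(\<Prod>i\<in>?N. block t (u i) i) = (\<Prod>i\<in>?N. block t (\<phi> g i) i)" for t
      using g(2) by (intro prod.cong) auto
    show ?thesis
      unfolding blocks by (rule invariant_as_permuted_blocks[OF V p g(1)])
  qed
  have neg: "(- 1 :: (nat \<times> nat) mpolynomial) ^ k = mp_const ((- 1) ^ k)" for k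
    by (simp add: mp_const_uminus flip: mp_const_power)
  \<comment> \<open>Averaging: \<open>p\<close> is added up once for each \<open>u\<close> in
    \<open>U\<close>, each time with its blocks permuted by \<open>u\<close>, so that polarization
    applies to every monomial.\<close>
  have "mp_const (real (card U)) * p = (\<Sum>u\<in>U. p)"
  proof -
    have "mp_const (real k) = (of_nat k :: (nat \<times> nat) mpolynomial)" for k
      by (simp add: mp_const_def)
    then show ?thesis by simp
  qed
  also have "\<dots> = (\<Sum>u\<in>U. \<Sum>t\<in>Poly_Mapping.keys p.
      mp_const (Poly_Mapping.lookup p t) * (\<Prod>i\<in>?N. block t (u i) i))"
    by (rule sum.cong[OF refl], rule pU)
  also have "\<dots> = (\<Sum>t\<in>Poly_Mapping.keys p. mp_const (Poly_Mapping.lookup p t) *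
      (\<Sum>u\<in>U. \<Prod>i\<in>?N. block t (u i) i))"
    by (subst sum.swap) (simp add: sum_distrib_left)
  also have "\<dots> = (\<Sum>t\<in>Poly_Mapping.keys p. mp_const (Poly_Mapping.lookup p t) *
      (\<Sum>S\<in>Pow ?N. (- 1) ^ card (?N - S) * (\<Prod>i\<in>?N. h (t, S) i)))"
  proof -
    have "(\<Sum>u\<in>U. \<Prod>i\<in>?N. block t (u i) i) =
        (\<Sum>S\<in>Pow ?N. (- 1) ^ card (?N - S) * (\<Prod>i\<in>?N. h (t, S) i))" for t
      unfolding U_def h_def prod.case
      by (rule polarization[where a = "\<lambda>i j. block t j i", OF _ B]) auto
    then show ?thesis by simp
  qed
  also have "\<dots> = (\<Sum>(t, S)\<in>Poly_Mapping.keys p \<times> Pow ?N.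
      mp_const (Poly_Mapping.lookup p t * (- 1) ^ card (?N - S)) * (\<Prod>i\<in>?N. h (t, S) i))"
    by (simp add: sum_distrib_left sum.cartesian_product mp_const_mult neg mult.assoc)
  finally have eq: "mp_const (real (card U)) * p = \<dots>" .
  have "p = mp_const (1 / real (card U)) * (mp_const (real (card U)) * p)"
    using cardU by (simp flip: mult.assoc mp_const_mult)
  also have "\<dots> = (\<Sum>l\<in>Poly_Mapping.keys p \<times> Pow ?N. mp_const (c l) * (\<Prod>i\<in>?N. h l i))"
    unfolding eq c_def sum_distrib_left
    by (intro sum.cong refl) (auto simp flip: mult.assoc mp_const_mult)
  finally have "p = (\<Sum>l\<in>Poly_Mapping.keys p \<times> Pow ?N. mp_const (c l) * (\<Prod>i\<in>?N. h l i))" .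
  moreover have "h l i \<in> local_ring m i" if li: "l \<in> Poly_Mapping.keys p \<times> Pow ?N" "i \<in> ?N" for l i
  proof -
    obtain t S where l: "l = (t, S)" "t \<in> Poly_Mapping.keys p"
      using li(1) by auto
    have "block t j i \<in> local_ring m i" if "j \<in> ?B i" for j
    proof (rule block_local)
      show "Poly_Mapping.keys t \<subseteq> (SIGMA i:{0..n}. {1..m i})"
        using p(1) l(2) by (auto simp: global_ring_def mp_over_def)
      show "m j = m i"
        using that m \<open>i \<in> ?N\<close> by (auto simp: orbit_def)
    qed
    then show ?thesis
      unfolding h_def l local_ring_def prod.case by (intro mp_over_sum) auto
  qed
  moreover have "at_block i (h l (\<phi> g i)) = h l i" if "i \<in> ?N" "g \<in> carrier G" for l i g
    using orbit_act[OF V that(2,1)]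
    by (cases l) (simp add: h_def at_block_def mp_subst_sum at_block_block[unfolded at_block_def])
  moreover have "finite (Poly_Mapping.keys p \<times> Pow ?N)"
    by simp
  ultimately show ?thesis
    by (intro exI[of _ "Poly_Mapping.keys p \<times> Pow ?N"] exI[of _ c] exI[of _ h]) blast
qed

section \<open>Separation of the coefficients by sign\<close>

theorem theorem20:
  fixes n :: nat
    and \<Omega> :: "nat set \<Rightarrow> nat"
    and G :: "('g, 'b) monoid_scheme"
    and \<phi> :: "'g \<Rightarrow> nat \<Rightarrow> nat"
    and \<psi> :: "'g \<Rightarrow> facet_copy \<Rightarrow> facet_copy"
    and m :: "nat \<Rightarrow> nat"
    and p :: "(nat \<times> nat) mpolynomial"
  assumes "weighted_simplicial_complex n \<Omega>"
    and "connected_complex n \<Omega>"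
    and "group G" and "finite (carrier G)"
    and "complex_action n \<Omega> G \<phi> \<psi>"
    and "blending n G \<phi>"
    and "\<forall>g \<in> carrier G. \<forall>i\<in>{0..n}. m (\<phi> g i) = m i"
    and "p \<in> global_ring n m"
    and "invariant_poly G \<phi> p"
  shows "(\<exists>q1 \<in> global_ring n m. \<exists>q2 \<in> global_ring n m.
            p = q1 - q2 \<and>
            has_decomposition n \<Omega> G \<phi> \<psi> m q1 \<and> has_decomposition n \<Omega> G \<phi> \<psi> m q2) \<and>
         (even n \<longrightarrow>
           (\<exists>q1 \<in> global_ring n m. \<exists>q2 \<in> global_ring n m.
              p = q1 - q2 \<and> q2 = 0 \<and>
              has_decomposition n \<Omega> G \<phi> \<psi> m q1 \<and> has_decomposition n \<Omega> G \<phi> \<psi> m q2))"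
proof -
  have V: "group_action G {0..n} \<phi>"
    using assms(5) by (simp add: complex_action_def)
  obtain L :: "((nat \<times> nat \<Rightarrow>\<^sub>0 nat) \<times> nat set) set" and c h where L: "finite L"
    and loc: "\<forall>l\<in>L. \<forall>i\<in>{0..n}. h l i \<in> local_ring m i"
    and equi: "\<forall>l\<in>L. \<forall>i\<in>{0..n}. \<forall>g\<in>carrier G. at_block i (h l (\<phi> g i)) = h l i"
    and p: "p = (\<Sum>l\<in>L. mp_const (c l) * (\<Prod>i\<in>{0..n}. h l i))"
    using invariant_as_equivariant_sum[OF V assms(6-9)] by (elim exE conjE)
  \<comment> \<open>The coefficients are a parameter because the negative part is used with reversed
    signs.\<close>
  define Q where "Q d M = (\<Sum>l\<in>M. mp_const (d l) * (\<Prod>i\<in>{0..n}. h l i))" for d M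
  have dec: "has_decomposition n \<Omega> G \<phi> \<psi> m (Q d M)"
    if "M \<subseteq> L" "\<And>l. l \<in> M \<Longrightarrow> \<exists>r. r ^ Suc n = d l" for d M
    unfolding Q_def using that L loc equi
    by (intro has_decomposition_of_equivariant[OF assms(1,2,5)]) (auto dest: finite_subset)
  have glob: "Q d M \<in> global_ring n m" if "M \<subseteq> L" for d M
    unfolding Q_def global_ring_def
  proof (intro mp_over_sum mp_over_mult mp_over_prod mp_over_const)
    fix l i assume "l \<in> M" "i \<in> {0..n}"
    then have "h l i \<in> mp_over ({i} \<times> {1..m i})"
      using loc that unfolding local_ring_def by blast
    moreover have "{i} \<times> {1..m i} \<subseteq> (SIGMA i:{0..n}. {1..m i})"
      using \<open>i \<in> {0..n}\<close> by auto
    ultimately show "h l i \<in> mp_over (SIGMA i:{0..n}. {1..m i})"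
      using mp_over_mono by blast
  qed
  have root: "\<exists>r. r ^ Suc n = x" if "0 \<le> x" for x :: real
    using real_root_pow_pos2[OF _ that, of "Suc n"] by blast
  \<comment> \<open>The summands with nonnegative coefficients form the first polynomial, the others
    after negation the second; in both, all coefficients have real roots of order
    \<open>n + 1\<close>.\<close>
  let ?A = "{l \<in> L. 0 \<le> c l}" and ?B = "{l \<in> L. \<not> 0 \<le> c l}"
  have "p = Q c ?A + Q c ?B"
    unfolding p Q_def using L by (subst sum.union_disjoint[symmetric]) (auto intro!: sum.cong)
  also have "Q c ?B = - Q (\<lambda>l. - c l) ?B"
    by (simp add: Q_def mp_const_uminus sum_negf)
  finally have p1: "p = Q c ?A - Q (\<lambda>l. - c l) ?B" by simp
  have A: "has_decomposition n \<Omega> G \<phi> \<psi> m (Q c ?A)"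
    by (rule dec) (blast, rule root, blast)
  have B: "has_decomposition n \<Omega> G \<phi> \<psi> m (Q (\<lambda>l. - c l) ?B)"
    by (rule dec) (blast, rule root, simp)
  have even: "has_decomposition n \<Omega> G \<phi> \<psi> m p" if "even n"
  proof -
    \<comment> \<open>Here \<open>n + 1\<close> is odd, so every real coefficient has a real root of
      this order and no splitting is required.\<close>
    have "\<exists>r. r ^ Suc n = c l" for l
      using that odd_real_root_pow[of "Suc n" "c l"] by auto
    then have "has_decomposition n \<Omega> G \<phi> \<psi> m (Q c L)"
      by (intro dec) auto
    then show ?thesis
      by (simp add: p Q_def)
  qed
  \<comment> \<open>The zero polynomial is the sum over the empty set of labels.\<close>
  have zero: "has_decomposition n \<Omega> G \<phi> \<psi> m 0" "0 \<in> global_ring n m"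
    using dec[of "{}" c] by (simp_all add: Q_def global_ring_def)
  show ?thesis
  proof (intro conjI impI)
    show "\<exists>q1\<in>global_ring n m. \<exists>q2\<in>global_ring n m. p = q1 - q2 \<and>
        has_decomposition n \<Omega> G \<phi> \<psi> m q1 \<and> has_decomposition n \<Omega> G \<phi> \<psi> m q2"
      by (intro bexI[of _ "Q c ?A"] bexI[of _ "Q (\<lambda>l. - c l) ?B"] conjI p1 A B glob) auto
    assume "even n"
    then show "\<exists>q1\<in>global_ring n m. \<exists>q2\<in>global_ring n m. p = q1 - q2 \<and> q2 = 0 \<and>
        has_decomposition n \<Omega> G \<phi> \<psi> m q1 \<and> has_decomposition n \<Omega> G \<phi> \<psi> m q2"
      using even zero assms(8) by (intro bexI[of _ p] bexI[of _ 0] conjI) auto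
  qed
qed

end
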